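(* Let $1\le k<n$ and let $(V,\mathcal{H})$ be a $k$-hypergraph with $n=|V|$ vertices such that at least one of the following holds: $k\in\{1,2\}$; $(V,\mathcal{H})$ is a $k$-partite hypergraph with respect to some $k$-partition of $V$; $(V,\mathcal{H})$ is a paving $k$-matroid; $(V,\mathcal{H})$ is a binary $k$-matroid; or $k=3$ and $(V,\mathcal{H})$ is a $3$-matroid. Then: (i) the complement $(V,\overline{\mathcal{H}})$ is equatable if and only if it is exchangeable; (ii) the dual $(V,\mathcal{H}^* )$ is equatable if and only if it is exchangeable. In particular, equatability is equivalent to exchangeability for every $k$-hypergraph ($k\ge 1$) with $n=k+1$ or $n=k+2$ vertices, for the dual of every paving $k$-matroid, and for the dual of every $3$-matroid.
   Context: A $k$-hypergraph is a pair $(V,\mathcal{H})$ with $V$ a finite set and $\mathcal{H}\subseteq\binom{V}{k}$ a set of $k$-element subsets of $V$ (the edges). Its complement is the $k$-hypergraph $(V,\overline{\mathcal{H}})$ with $\overline{\mathcal{H}}:=\binom{V}{k}\setminus\mathcal{H}$. Its dual is the $(n-k)$-hypergraph $(V,\mathcal{H}^* )$ with $\mathcal{H}^*:=\{V\setminus E:E\in\mathcal{H}\}$, where $n=|V|$. Standing assumption: $1\le k<n$. Equatable: there is a labeling $y:\binom{V}{k}\to\mathbb{R}_{\ge 0}$, not identically zero, such that for every $v\in V$, $\sum\{y(E):v\in E\in\mathcal{H}\}=\sum\{y(F):v\in F\in\overline{\mathcal{H}}\}$. Exchangeable: there are $E_1,E_2\in\mathcal{H}$, $v_1\in E_1\setminus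 E_2$ and $v_2\in E_2\setminus E_1$ such that $(E_1\setminus\{v_1\})\cup\{v_2\}\in\overline{\mathcal{H}}$ and $(E_2\setminus\{v_2\})\cup\{v_1\}\in\overline{\mathcal{H}}$. (These two notions are applied to the dual as an $(n-k)$-hypergraph, i.e. with $k$ replaced by $n-k$.) $k$-partite hypergraph: a $k$-hypergraph $(V,\mathcal{H})$ with a specified partition $V=V_1\uplus\cdots\uplus V_k$ into pairwise disjoint sets such that $|E\cap V_i|=1$ for every $E\in\mathcal{H}$ and every $i=1,\dots,k$. $k$-matroid: a $k$-hypergraph $(V,\mathcal{H})$ with $\mathcal{H}\ne\emptyset$ such that for every $E_1,E_2\in\mathcal{H}$ and $v_1\in E_1\setminus E_2$ there is $v_2\in E_2\setminus E_1$ with $(E_1\setminus\{v_1\})\cup\{v_2\}\in\mathcal{H}$ (that is, $\mathcal{H}$ is the set of bases of a rank $k$ matroid on $V$). A set $I\subseteq V$ is independent if $I\subseteq E$ for some $E\in\mathcal{H}$. A circuit is a subset of $V$ which is not independent but all of whose proper subsets are independent. Paving $k$-matroid: a $k$-matroid in which every $(k-1)$-subset of $V$ is independent. Binary $k$-matroid: a $k$-matroid in which, for any two distinct circuits $C_1,C_2$, the symmetric difference $C_1\Delta C_2$ is a disjoint union of circuits. *)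

theory Defs
  imports Complex_Main "HOL-Library.Ramsey" "HOL-Library.Disjoint_Sets"
begin

text \<open>The set of \<open>k\<close>-element subsets of \<open>V\<close> is \<open>[V]\<^bsup>k\<^esup>\<close> from \<open>HOL-Library.Ramsey\<close>. A hypergraph is given
  by \<open>k\<close>, its vertex set \<open>V\<close> and its edge set \<open>H\<close>; \<open>k\<close> has to be kept as a parameter since it is
  not determined by \<open>V\<close> and \<open>H\<close> when \<open>H\<close> is empty.\<close>

definition hypergraph :: "nat \<Rightarrow> 'a set \<Rightarrow> 'a set set \<Rightarrow> bool" where
  "hypergraph k V H \<longleftrightarrow> finite V \<and> H \<subseteq> [V]\<^bsup>k\<^esup>"

definition compl_edges :: "nat \<Rightarrow> 'a set \<Rightarrow> 'a set set \<Rightarrow> 'a set set" where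
  "compl_edges k V H = [V]\<^bsup>k\<^esup> - H"

definition dual_edges :: "'a set \<Rightarrow> 'a set set \<Rightarrow> 'a set set" where
  "dual_edges V H = {V - E |E. E \<in> H}"

text \<open>The labeling is a total function, but only its values on \<open>[V]\<^bsup>k\<^esup>\<close> are constrained or used.\<close>

definition equatable :: "nat \<Rightarrow> 'a set \<Rightarrow> 'a set set \<Rightarrow> bool" where
  "equatable k V H \<longleftrightarrow>
     (\<exists>y :: 'a set \<Rightarrow> real.
        (\<forall>E\<in>[V]\<^bsup>k\<^esup>. y E \<ge> 0) \<and> (\<exists>E\<in>[V]\<^bsup>k\<^esup>. y E \<noteq> 0) \<and>
        (\<forall>v\<in>V. (\<Sum>E\<in>{E \<in> H. v \<in> E}. y E) = (\<Sum>F\<in>{F \<in> compl_edges k V H. v \<in> F}. y F)))"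

definition exchangeable :: "nat \<Rightarrow> 'a set \<Rightarrow> 'a set set \<Rightarrow> bool" where
  "exchangeable k V H \<longleftrightarrow>
     (\<exists>E1\<in>H. \<exists>E2\<in>H. \<exists>v1\<in>E1 - E2. \<exists>v2\<in>E2 - E1.
        (E1 - {v1}) \<union> {v2} \<in> compl_edges k V H \<and> (E2 - {v2}) \<union> {v1} \<in> compl_edges k V H)"

definition partite_wrt :: "nat \<Rightarrow> 'a set \<Rightarrow> 'a set set \<Rightarrow> (nat \<Rightarrow> 'a set) \<Rightarrow> bool" where
  "partite_wrt k V H P \<longleftrightarrow>
     hypergraph k V H \<and> disjoint_family_on P {1..k} \<and> (\<Union>i\<in>{1..k}. P i) = V \<and>
     (\<forall>E\<in>H. \<forall>i\<in>{1..k}. card (E \<inter> P i) = 1)"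

definition matroid :: "nat \<Rightarrow> 'a set \<Rightarrow> 'a set set \<Rightarrow> bool" where
  "matroid k V H \<longleftrightarrow>
     hypergraph k V H \<and> H \<noteq> {} \<and>
     (\<forall>E1\<in>H. \<forall>E2\<in>H. \<forall>v1\<in>E1 - E2. \<exists>v2\<in>E2 - E1. (E1 - {v1}) \<union> {v2} \<in> H)"

definition indep :: "'a set set \<Rightarrow> 'a set \<Rightarrow> bool" where
  "indep H I \<longleftrightarrow> (\<exists>E\<in>H. I \<subseteq> E)"

definition circuit :: "'a set \<Rightarrow> 'a set set \<Rightarrow> 'a set \<Rightarrow> bool" where
  "circuit V H C \<longleftrightarrow> C \<subseteq> V \<and> \<not> indep H C \<and> (\<forall>I. I \<subset> C \<longrightarrow> indep H I)"

definition paving_matroid :: "nat \<Rightarrow> 'a set \<Rightarrow> 'a set set \<Rightarrow> bool" where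
  "paving_matroid k V H \<longleftrightarrow> matroid k V H \<and> (\<forall>I\<in>[V]\<^bsup>(k - 1)\<^esup>. indep H I)"

definition binary_matroid :: "nat \<Rightarrow> 'a set \<Rightarrow> 'a set set \<Rightarrow> bool" where
  "binary_matroid k V H \<longleftrightarrow>
     matroid k V H \<and>
     (\<forall>C1 C2. circuit V H C1 \<and> circuit V H C2 \<and> C1 \<noteq> C2 \<longrightarrow>
        (\<exists>\<C>. (\<forall>C\<in>\<C>. circuit V H C) \<and> disjoint \<C> \<and> sym_diff C1 C2 = \<Union>\<C>))"

end

theory Submission
  imports Defs
begin

text \<open>
  Complementing exchanges the two sides of the balance equations, and dualizing replaces each
  equation by its difference from the total label of either side; both operations also carry an
  exchange to an exchange. So the claims about complements and duals reduce to the equivalence for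
  the hypergraph itself, and the case of \<open>k + 1\<close> or \<open>k + 2\<close> vertices is dual to edges of size one or two.

  An exchange gives a balanced labeling at once: put the label one on the two given edges and on the
  two non-edges obtained from them. The work is in the converse, namely that a hypergraph without an
  exchange has only the zero labeling. A certificate for this is a vertex weighting with the edges on
  one side of a threshold and the non-edges on the other: pairing the balance equations with the
  weights then forces every label to vanish (lemma \<open>separating_weight_imp_not_equatable\<close>).

  Without an exchange, any two vertices \<open>x\<close>, \<open>c\<close> are comparable: one of them can replace the other in
  every edge that contains only the other. Counting shows that the better of the two is the one of
  larger degree (lemma \<open>not_exchangeable_swap\<close>), so sorting by degree gives a linear preorder that
  rules the hypergraph. In a graph the two extreme vertices can be eliminated one after the
  other. In a partite hypergraph the comparisons force all edges to agree outside one part.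

  In a matroid, let \<open>c\<close> be a vertex of largest degree in a circuit \<open>C\<close>. The vertices of degree at most
  \<open>deg c\<close> have rank \<open>card C - 1\<close> (lemma \<open>indep_below_top\<close>), since an independent set obtained from
  \<open>C - {c}\<close> by adding such a vertex could be turned into one containing \<open>C\<close>. Hence the bases are cut
  out by rank bounds on a chain of sets that are closed under lowering the degree. For paving matroids
  one bound suffices, for rank three there are three bounds, and for binary
  matroids the circuits that avoid the vertex of top degree have at most two elements, which again
  leaves three bounds. The bounds on at most three sets that arise are all handled by one explicit weighting
  (lemma \<open>three_constraints_imp_not_equatable\<close>).
\<close>

section \<open>Complement and dual\<close>

lemma finite_edges:
  assumes "hypergraph k V H"
  shows "finite V" "H \<subseteq> [V]\<^bsup>k\<^esup>" "finite ([V]\<^bsup>k\<^esup>)" "finite H"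
  using assms finite_imp_finite_nsets[of V k] unfolding hypergraph_def
  by (auto intro: finite_subset)

lemma hypergraph_edge:
  assumes "hypergraph k V H" "E \<in> H"
  shows "E \<subseteq> V" "finite E" "card E = k"
  using assms unfolding hypergraph_def nsets_def by auto

lemma hypergraph_compl: "hypergraph k V H \<Longrightarrow> hypergraph k V (compl_edges k V H)"
  unfolding hypergraph_def compl_edges_def by auto

lemma compl_compl: "hypergraph k V H \<Longrightarrow> compl_edges k V (compl_edges k V H) = H"
  unfolding hypergraph_def compl_edges_def by auto

lemma equatable_compl:
  assumes "hypergraph k V H"
  shows "equatable k V (compl_edges k V H) \<longleftrightarrow> equatable k V H"
  unfolding equatable_def compl_compl[OF assms]
  by (intro iff_exI conj_cong refl ball_cong eq_commute)

lemma exchangeable_complI: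
  assumes "exchangeable k V H" "hypergraph k V H"
  shows "exchangeable k V (compl_edges k V H)"
proof -
  obtain E1 E2 v1 v2 where *: "E1 \<in> H" "E2 \<in> H" "v1 \<in> E1 - E2" "v2 \<in> E2 - E1"
    "(E1 - {v1}) \<union> {v2} \<in> compl_edges k V H" "(E2 - {v2}) \<union> {v1} \<in> compl_edges k V H"
    using assms(1) unfolding exchangeable_def by blast
  let ?F1 = "(E1 - {v1}) \<union> {v2}" and ?F2 = "(E2 - {v2}) \<union> {v1}"
  have "v2 \<in> ?F1 - ?F2" "v1 \<in> ?F2 - ?F1" "(?F1 - {v2}) \<union> {v1} = E1" "(?F2 - {v1}) \<union> {v2} = E2"
    using * by auto
  then show ?thesis
    unfolding exchangeable_def compl_compl[OF assms(2)] using * by metis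
qed

lemma exchangeable_compl:
  assumes "hypergraph k V H"
  shows "exchangeable k V (compl_edges k V H) \<longleftrightarrow> exchangeable k V H"
  using exchangeable_complI[OF _ assms] exchangeable_complI[OF _ hypergraph_compl[OF assms]]
    compl_compl[OF assms] by auto

lemma dual_edges_image: "dual_edges V H = (\<lambda>E. V - E) ` H"
  unfolding dual_edges_def by auto

lemma inj_on_Diff_edges: "hypergraph k V H \<Longrightarrow> inj_on (\<lambda>E. V - E) H"
  unfolding hypergraph_def nsets_def by (intro inj_onI) blast

lemma dual_nsets:
  assumes "finite V" "k \<le> card V"
  shows "dual_edges V ([V]\<^bsup>k\<^esup>) = [V]\<^bsup>(card V - k)\<^esup>"
proof (intro set_eqI iffI)
  fix F assume "F \<in> [V]\<^bsup>(card V - k)\<^esup>"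
  then have "V - F \<in> [V]\<^bsup>k\<^esup>" "F = V - (V - F)"
    using assms by (auto simp: nsets_def card_Diff_subset)
  then show "F \<in> dual_edges V ([V]\<^bsup>k\<^esup>)" unfolding dual_edges_def by blast
qed (use assms in \<open>auto simp: dual_edges_def nsets_def card_Diff_subset\<close>)

lemma hypergraph_dual:
  assumes "hypergraph k V H" "k \<le> card V"
  shows "hypergraph (card V - k) V (dual_edges V H)"
  using assms dual_nsets[of V k] unfolding hypergraph_def dual_edges_image by blast

lemma dual_dual: "hypergraph k V H \<Longrightarrow> dual_edges V (dual_edges V H) = H"
  unfolding dual_edges_image image_image hypergraph_def nsets_def
  by (auto simp: image_iff double_diff subset_iff)

lemma compl_dual:
  assumes "hypergraph k V H" "k \<le> card V"
  shows "compl_edges (card V - k) V (dual_edges V H) = dual_edges V (compl_edges k V H)"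
proof -
  have fin: "finite V" using finite_edges[OF assms(1)] by blast
  have "inj_on (\<lambda>E. V - E) ([V]\<^bsup>k\<^esup>)"
    by (rule inj_on_Diff_edges[of k]) (use fin in \<open>simp add: hypergraph_def\<close>)
  then show ?thesis
    unfolding compl_edges_def dual_nsets[OF fin assms(2), symmetric] dual_edges_image
    using finite_edges[OF assms(1)] by (simp add: inj_on_image_set_diff)
qed

text \<open>Pairing the balance equations with a vertex weighting turns them into statements about the weights
  of edges; the weighting by ones gives the equality of the two total labels.\<close>

lemma weighted_double_count:
  fixes y :: "'a set \<Rightarrow> real" and w :: "'a \<Rightarrow> real"
  assumes "hypergraph k V H"
  shows "(\<Sum>v\<in>V. w v * (\<Sum>E\<in>{E \<in> H. v \<in> E}. y E)) = (\<Sum>E\<in>H. y E * sum w E)"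
proof -
  note fin = finite_edges[OF assms]
  have "(\<Sum>v\<in>V. w v * (\<Sum>E\<in>{E \<in> H. v \<in> E}. y E)) = (\<Sum>v\<in>V. \<Sum>E\<in>{E \<in> H. v \<in> E}. y E * w v)"
    by (simp add: sum_distrib_left mult.commute)
  also have "\<dots> = (\<Sum>E\<in>H. \<Sum>v\<in>{v \<in> V. v \<in> E}. y E * w v)"
    by (rule sum.swap_restrict) (use fin in auto)
  also have "\<dots> = (\<Sum>E\<in>H. y E * sum w E)"
  proof (rule sum.cong)
    fix E assume "E \<in> H"
    then have "{v \<in> V. v \<in> E} = E" using hypergraph_edge[OF assms] by blast
    then show "(\<Sum>v\<in>{v \<in> V. v \<in> E}. y E * w v) = y E * sum w E"
      by (simp add: sum_distrib_left)
  qed simp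
  finally show ?thesis .
qed

lemma balanced_totals:
  fixes y :: "'a set \<Rightarrow> real"
  assumes "hypergraph k V H" "1 \<le> k"
    and bal: "\<And>v. v \<in> V \<Longrightarrow>
      (\<Sum>E\<in>{E \<in> H. v \<in> E}. y E) = (\<Sum>F\<in>{F \<in> compl_edges k V H. v \<in> F}. y F)"
  shows "sum y H = sum y (compl_edges k V H)"
proof -
  have total: "(\<Sum>v\<in>V. 1 * (\<Sum>E\<in>{E \<in> G. v \<in> E}. y E)) = real k * sum y G"
    if "hypergraph k V G" for G
    unfolding weighted_double_count[OF that]
    by (subst sum_distrib_left) (auto intro!: sum.cong simp: hypergraph_edge[OF that])
  have "real k * sum y H = real k * sum y (compl_edges k V H)"
    unfolding total[OF assms(1), symmetric] total[OF hypergraph_compl[OF assms(1)], symmetric]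
    using bal by (intro sum.cong) auto
  then show ?thesis using assms(2) by simp
qed

text \<open>The edges of the dual through \<open>v\<close> come from the edges avoiding \<open>v\<close>, so transporting a labeling
  replaces both sides at \<open>v\<close> by their differences from the totals, and the totals agree.\<close>

lemma equatable_dualI:
  assumes "equatable k V H" "hypergraph k V H" "1 \<le> k" "k \<le> card V"
  shows "equatable (card V - k) V (dual_edges V H)"
proof -
  obtain y :: "'a set \<Rightarrow> real" where y: "\<forall>E\<in>[V]\<^bsup>k\<^esup>. y E \<ge> 0" "\<exists>E\<in>[V]\<^bsup>k\<^esup>. y E \<noteq> 0"
    and bal: "\<And>v. v \<in> V \<Longrightarrow>
      (\<Sum>E\<in>{E \<in> H. v \<in> E}. y E) = (\<Sum>F\<in>{F \<in> compl_edges k V H. v \<in> F}. y F)"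
    using assms(1) unfolding equatable_def by blast
  let ?y = "\<lambda>F. y (V - F)"
  note fin = finite_edges[OF assms(2)]
  have dd: "V - (V - E) = E" if "E \<in> [V]\<^bsup>k\<^esup>" for E
    using that unfolding nsets_def by auto
  have avoid: "(\<Sum>F\<in>{F \<in> dual_edges V G. v \<in> F}. ?y F) = sum y G - (\<Sum>E\<in>{E \<in> G. v \<in> E}. y E)"
    if G: "hypergraph k V G" and v: "v \<in> V" for G v
  proof -
    have "{F \<in> dual_edges V G. v \<in> F} = (\<lambda>E. V - E) ` {E \<in> G. v \<notin> E}"
      using v unfolding dual_edges_image by auto
    then have "(\<Sum>F\<in>{F \<in> dual_edges V G. v \<in> F}. ?y F) = (\<Sum>E\<in>{E \<in> G. v \<notin> E}. ?y (V - E))"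
      by (simp add: sum.reindex inj_on_subset[OF inj_on_Diff_edges[OF G]])
    also have "\<dots> = (\<Sum>E\<in>{E \<in> G. v \<notin> E}. y E)"
      using dd finite_edges(2)[OF G] by (intro sum.cong) (auto simp: subset_iff)
    also have "\<dots> = sum y (G - {E \<in> G. v \<in> E})"
      by (rule arg_cong[where f = "sum y"]) auto
    also have "\<dots> = sum y G - (\<Sum>E\<in>{E \<in> G. v \<in> E}. y E)"
      by (rule sum_diff) (use finite_edges[OF G] in auto)
    finally show ?thesis .
  qed
  have "(\<Sum>F\<in>{F \<in> dual_edges V H. v \<in> F}. ?y F)
      = (\<Sum>F\<in>{F \<in> compl_edges (card V - k) V (dual_edges V H). v \<in> F}. ?y F)" if "v \<in> V" for v
    unfolding compl_dual[OF assms(2,4)] avoid[OF assms(2) that]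
      avoid[OF hypergraph_compl[OF assms(2)] that]
    using bal[OF that] balanced_totals[OF assms(2,3) bal] by simp
  moreover have "\<forall>F\<in>[V]\<^bsup>(card V - k)\<^esup>. ?y F \<ge> 0" "\<exists>F\<in>[V]\<^bsup>(card V - k)\<^esup>. ?y F \<noteq> 0"
    unfolding dual_nsets[OF fin(1) assms(4), symmetric] dual_edges_image using y dd by auto
  ultimately show ?thesis unfolding equatable_def by (intro exI[of _ ?y]) auto
qed

text \<open>Exchanging \<open>v1\<close> for \<open>v2\<close> in a set exchanges \<open>v2\<close> for \<open>v1\<close> in its complement, so the same pair of
  vertices works in the dual with its roles interchanged.\<close>

lemma exchangeable_dualI:
  assumes "exchangeable k V H" "hypergraph k V H" "k \<le> card V"
  shows "exchangeable (card V - k) V (dual_edges V H)"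
proof -
  obtain E1 E2 v1 v2 where *: "E1 \<in> H" "E2 \<in> H" "v1 \<in> E1 - E2" "v2 \<in> E2 - E1"
    "(E1 - {v1}) \<union> {v2} \<in> compl_edges k V H" "(E2 - {v2}) \<union> {v1} \<in> compl_edges k V H"
    using assms(1) unfolding exchangeable_def by blast
  let ?D = "\<lambda>E. V - E"
  have V: "v1 \<in> V" "v2 \<in> V" using * hypergraph_edge[OF assms(2)] by blast+
  have "?D E1 \<in> dual_edges V H" "?D E2 \<in> dual_edges V H" "v2 \<in> ?D E1 - ?D E2" "v1 \<in> ?D E2 - ?D E1"
    using * V unfolding dual_edges_image by auto
  moreover have "(?D E1 - {v2}) \<union> {v1} = ?D ((E1 - {v1}) \<union> {v2})"
    "(?D E2 - {v1}) \<union> {v2} = ?D ((E2 - {v2}) \<union> {v1})"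
    using * V by auto
  then have "(?D E1 - {v2}) \<union> {v1} \<in> dual_edges V (compl_edges k V H)"
    "(?D E2 - {v1}) \<union> {v2} \<in> dual_edges V (compl_edges k V H)"
    using * unfolding dual_edges_image by auto
  ultimately show ?thesis
    unfolding exchangeable_def compl_dual[OF assms(2,3)] by blast
qed

lemma equatable_dual:
  assumes "hypergraph k V H" "1 \<le> k" "k < card V"
  shows "equatable (card V - k) V (dual_edges V H) \<longleftrightarrow> equatable k V H"
  using equatable_dualI[OF _ assms(1,2)] assms
    equatable_dualI[of "card V - k" V "dual_edges V H"] hypergraph_dual[OF assms(1)]
    dual_dual[OF assms(1)] by auto

lemma exchangeable_dual:
  assumes "hypergraph k V H" "k < card V"
  shows "exchangeable (card V - k) V (dual_edges V H) \<longleftrightarrow> exchangeable k V H"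
  using exchangeable_dualI[OF _ assms(1)] assms
    exchangeable_dualI[of "card V - k" V "dual_edges V H"] hypergraph_dual[OF assms(1)]
    dual_dual[OF assms(1)] by auto

section \<open>Equatability from exchanges, non-equatability from weights\<close>

text \<open>The two edges and the two non-edges of an exchange have the same sum of indicator vectors.\<close>

lemma exchangeable_imp_equatable:
  assumes "hypergraph k V H" "exchangeable k V H"
  shows "equatable k V H"
proof -
  obtain E1 E2 v1 v2 where *: "E1 \<in> H" "E2 \<in> H" "v1 \<in> E1 - E2" "v2 \<in> E2 - E1"
    "(E1 - {v1}) \<union> {v2} \<in> compl_edges k V H" "(E2 - {v2}) \<union> {v1} \<in> compl_edges k V H"
    using assms(2) unfolding exchangeable_def by blast
  define F1 where "F1 = (E1 - {v1}) \<union> {v2}"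
  define F2 where "F2 = (E2 - {v2}) \<union> {v1}"
  note F = F1_def F2_def
  have inC: "F1 \<in> compl_edges k V H" "F2 \<in> compl_edges k V H" using * F by auto
  have notH: "F1 \<notin> H" "F2 \<notin> H" "E1 \<notin> compl_edges k V H" "E2 \<notin> compl_edges k V H"
    using inC * unfolding compl_edges_def by auto
  have ne: "E1 \<noteq> E2" "F1 \<noteq> F2" using * F by auto
  let ?S = "{E1, E2, F1, F2}"
  let ?y = "\<lambda>E. if E \<in> ?S then 1 else 0 :: real"
  have count: "(\<Sum>E\<in>{E \<in> G. v \<in> E}. ?y E) = of_bool (v \<in> A) + of_bool (v \<in> B)"
    if "finite G" "A \<in> G" "B \<in> G" "A \<noteq> B" "G \<inter> ?S = {A, B}" for G v A B
  proof -
    have "(\<Sum>E\<in>{E \<in> G. v \<in> E}. ?y E) = (\<Sum>E\<in>{A, B}. of_bool (v \<in> E))"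
      by (rule sum.mono_neutral_cong) (use that in auto)
    then show ?thesis using that(4) by simp
  qed
  have "(\<Sum>E\<in>{E \<in> H. v \<in> E}. ?y E) = (\<Sum>F\<in>{F \<in> compl_edges k V H. v \<in> F}. ?y F)" for v
  proof -
    have "(\<Sum>E\<in>{E \<in> H. v \<in> E}. ?y E) = of_bool (v \<in> E1) + of_bool (v \<in> E2)"
      by (rule count) (use * ne notH finite_edges[OF assms(1)] in auto)
    moreover have "(\<Sum>F\<in>{F \<in> compl_edges k V H. v \<in> F}. ?y F) = of_bool (v \<in> F1) + of_bool (v \<in> F2)"
      by (rule count) (use inC ne notH finite_edges[OF hypergraph_compl[OF assms(1)]] in auto)
    ultimately show ?thesis using * by (auto simp: F)
  qed
  moreover have "E1 \<in> [V]\<^bsup>k\<^esup>" using * finite_edges[OF assms(1)] by auto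
  ultimately show ?thesis unfolding equatable_def by (intro exI[of _ ?y]) auto
qed

text \<open>Both sides of the balance have the same total label and the same total weighted label. Edges weigh
  less than \<open>t\<close> and non-edges at least \<open>t\<close>, so the balance leaves no positive label on an edge; the
  total is then zero, which removes the labels of the non-edges as well.\<close>

lemma separating_weight_imp_not_equatable:
  fixes w :: "'a \<Rightarrow> real"
  assumes "hypergraph k V H" "1 \<le> k"
    and sep: "\<And>E. E \<in> [V]\<^bsup>k\<^esup> \<Longrightarrow> E \<in> H \<longleftrightarrow> sum w E < t"
  shows "\<not> equatable k V H"
proof
  assume "equatable k V H"
  then obtain y :: "'a set \<Rightarrow> real" where y: "\<forall>E\<in>[V]\<^bsup>k\<^esup>. y E \<ge> 0" "\<exists>E\<in>[V]\<^bsup>k\<^esup>. y E \<noteq> 0"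
    and bal: "\<And>v. v \<in> V \<Longrightarrow>
      (\<Sum>E\<in>{E \<in> H. v \<in> E}. y E) = (\<Sum>F\<in>{F \<in> compl_edges k V H. v \<in> F}. y F)"
    unfolding equatable_def by blast
  let ?C = "compl_edges k V H"
  note fin = finite_edges[OF assms(1)] and finC = finite_edges[OF hypergraph_compl[OF assms(1)]]
  have tot: "sum y H = sum y ?C" by (rule balanced_totals[OF assms(1,2) bal])
  have weighted: "(\<Sum>E\<in>H. y E * sum w E) = (\<Sum>F\<in>?C. y F * sum w F)"
    unfolding weighted_double_count[OF assms(1), symmetric]
      weighted_double_count[OF hypergraph_compl[OF assms(1)], symmetric]
    using bal by (intro sum.cong) auto
  have "(\<Sum>E\<in>H. y E * (t - sum w E)) = t * sum y H - (\<Sum>E\<in>H. y E * sum w E)"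
    by (simp add: right_diff_distrib sum_subtractf sum_distrib_left mult.commute)
  also have "\<dots> = (\<Sum>F\<in>?C. y F * (t - sum w F))"
    unfolding tot weighted
    by (simp add: right_diff_distrib sum_subtractf sum_distrib_left mult.commute)
  also have "\<dots> \<le> 0"
    using y sep by (intro sum_nonpos) (auto simp: compl_edges_def not_less intro!: mult_nonneg_nonpos)
  finally have le: "(\<Sum>E\<in>H. y E * (t - sum w E)) \<le> 0" .
  have nn: "\<forall>E\<in>H. 0 \<le> y E * (t - sum w E)"
    using y sep fin(2) by (auto intro!: mult_nonneg_nonneg simp: subset_iff less_imp_le)
  then have "\<forall>E\<in>H. y E * (t - sum w E) = 0"
    using le fin(4) by (metis (no_types, lifting) antisym sum_nonneg sum_nonneg_eq_0_iff)
  then have yH: "\<forall>E\<in>H. y E = 0" using sep fin(2) by fastforce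
  then have "sum y ?C = 0" using tot by simp
  then have "\<forall>F\<in>?C. y F = 0"
    using y finC by (subst (asm) sum_nonneg_eq_0_iff) auto
  then show False using yH y(2) unfolding compl_edges_def by blast
qed

text \<open>The sets \<open>A\<close>, \<open>B\<close>, \<open>D\<close> carry rank bounds zero, one and \<open>t - 1\<close>. The weighting counts \<open>2 * t\<close> for \<open>A\<close>, one
  for \<open>B\<close> and two for \<open>D\<close>. An edge weighs at most \<open>1 + 2 * (t - 1)\<close>, while each
  violation of a bound weighs at least \<open>2 * t\<close>. A set that violates only the bound on \<open>B\<close> reaches this
  weight because it is assumed to meet \<open>D\<close> in at least \<open>t - 1\<close> vertices.\<close>

lemma three_constraints_imp_not_equatable:
  assumes H: "hypergraph k V H" and k: "1 \<le> k" and t: "1 \<le> t"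
    and mem: "\<And>E. E \<in> H \<Longrightarrow> E \<inter> A = {} \<and> card (E \<inter> B) \<le> 1 \<and> card (E \<inter> D) < t"
    and nonmem: "\<And>E. E \<in> [V]\<^bsup>k\<^esup> \<Longrightarrow> E \<notin> H \<Longrightarrow>
      E \<inter> A \<noteq> {} \<or> 2 \<le> card (E \<inter> B) \<and> t \<le> card (E \<inter> D) + 1 \<or> t \<le> card (E \<inter> D)"
  shows "\<not> equatable k V H"
proof -
  let ?w = "\<lambda>v. 2 * real t * of_bool (v \<in> A) + of_bool (v \<in> B) + 2 * of_bool (v \<in> D)"
  have w: "sum ?w E = real (2 * t * card (E \<inter> A) + card (E \<inter> B) + 2 * card (E \<inter> D))"
    if "finite E" for E
  proof -
    have ind: "(\<Sum>v\<in>E. of_bool (v \<in> X)) = real (card (E \<inter> X))" for X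
      using that by (simp add: of_bool_def sum.If_cases Int_def)
    show ?thesis
      by (simp add: sum.distrib sum_distrib_left[symmetric] ind del: sum_of_bool_eq)
  qed
  show ?thesis
  proof (rule separating_weight_imp_not_equatable[OF H k, of ?w "real (2 * t)"])
    fix E assume E: "E \<in> [V]\<^bsup>k\<^esup>"
    then have fin: "finite E" by (simp add: nsets_def)
    show "E \<in> H \<longleftrightarrow> sum ?w E < real (2 * t)"
    proof
      assume "E \<in> H"
      then have "E \<inter> A = {}" "card (E \<inter> B) \<le> 1" "card (E \<inter> D) < t" using mem by auto
      then have "2 * t * card (E \<inter> A) + card (E \<inter> B) + 2 * card (E \<inter> D) < 2 * t" by simp
      then show "sum ?w E < real (2 * t)" unfolding w[OF fin] of_nat_less_iff .
    next
      assume "sum ?w E < real (2 * t)"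
      then have lt: "2 * t * card (E \<inter> A) + card (E \<inter> B) + 2 * card (E \<inter> D) < 2 * t"
        unfolding w[OF fin] of_nat_less_iff .
      have "E \<inter> A = {}"
      proof (rule ccontr)
        assume "E \<inter> A \<noteq> {}"
        then have "1 \<le> card (E \<inter> A)" using fin by (simp add: Suc_le_eq card_gt_0_iff)
        then have "2 * t * 1 \<le> 2 * t * card (E \<inter> A)" by (rule mult_le_mono2)
        then show False using lt by linarith
      qed
      then show "E \<in> H" using nonmem[OF E] lt by fastforce
    qed
  qed
qed

section \<open>Degrees in non-exchangeable hypergraphs\<close>

definition degree :: "'a set set \<Rightarrow> 'a \<Rightarrow> nat" where
  "degree H v = card {E \<in> H. v \<in> E}"

text \<open>If \<open>c\<close> could not replace \<open>x\<close> in the edge \<open>E\<close>, then \<open>x\<close> could replace \<open>c\<close> in every edge containing only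
  \<open>c\<close>, as a failure there would be an exchange together with \<open>E\<close>. This replacement is an injection
  that misses \<open>E\<close>, so the degree of \<open>x\<close> would exceed that of \<open>c\<close>.\<close>

lemma not_exchangeable_swap:
  assumes H: "hypergraph k V H" and ne: "\<not> exchangeable k V H"
    and E: "E \<in> H" "x \<in> E" "c \<notin> E" and c: "c \<in> V" and deg: "degree H x \<le> degree H c"
  shows "insert c (E - {x}) \<in> H"
proof (rule ccontr)
  assume nm: "insert c (E - {x}) \<notin> H"
  note fin = finite_edges[OF H]
  have swap_edge: "insert b (G - {a}) \<in> [V]\<^bsup>k\<^esup>" if "G \<in> H" "a \<in> G" "b \<notin> G" "b \<in> V" for a b G
    using hypergraph_edge[OF H that(1)] that
    by (auto simp: nsets_def card_insert_if card_Diff_singleton) (metis Suc_pred card_gt_0_iff empty_iff)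
  have xV: "x \<in> V" using E hypergraph_edge[OF H] by blast
  let ?c = "{G \<in> H. c \<in> G \<and> x \<notin> G}" and ?x = "{G \<in> H. x \<in> G \<and> c \<notin> G}"
  let ?f = "\<lambda>G. insert x (G - {c})"
  have swap_back: "?f G \<in> H" if "G \<in> ?c" for G
  proof (rule ccontr)
    assume "?f G \<notin> H"
    then have "exchangeable k V H"
      unfolding exchangeable_def compl_edges_def
      using nm that E swap_edge[OF E c] swap_edge[of G c x] xV
      by (intro bexI[of _ E] bexI[of _ G] bexI[of _ x] bexI[of _ c]) auto
    then show False using ne by simp
  qed
  have "inj_on ?f ?c" by (rule inj_on_inverseI[of _ "\<lambda>F. insert c (F - {x})"]) auto
  moreover have "?f ` ?c \<subseteq> ?x - {E}"
  proof
    fix F assume "F \<in> ?f ` ?c"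
    then obtain G where G: "G \<in> ?c" "F = ?f G" by blast
    have "F \<noteq> E"
    proof
      assume "F = E"
      then have "insert c (E - {x}) = G" using G by auto
      then show False using nm G by simp
    qed
    moreover have "c \<noteq> x" using E by auto
    ultimately show "F \<in> ?x - {E}" using swap_back[OF G(1)] G by auto
  qed
  ultimately have "card ?c \<le> card (?x - {E})"
    using fin by (intro card_inj_on_le) auto
  also have "\<dots> < card ?x" using fin E by (intro psubset_card_mono) auto
  finally have lt: "card ?c < card ?x" .
  let ?b = "{G \<in> H. x \<in> G \<and> c \<in> G}"
  have "degree H c = card ?b + card ?c" unfolding degree_def
    using fin by (subst card_Un_disjoint[symmetric]) (auto intro: arg_cong[where f = card])
  moreover have "degree H x = card ?b + card ?x" unfolding degree_def
    using fin by (subst card_Un_disjoint[symmetric]) (auto intro: arg_cong[where f = card])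
  ultimately show False using lt deg by simp
qed

lemma ex_max_degree:
  assumes "finite S" "S \<noteq> {}"
  obtains c where "c \<in> S" "\<And>x. x \<in> S \<Longrightarrow> degree H x \<le> degree H c"
proof -
  have "Max (degree H ` S) \<in> degree H ` S" using assms by simp
  then obtain c where "c \<in> S" "degree H c = Max (degree H ` S)" by auto
  then show thesis using that assms by simp
qed

section \<open>Graphs\<close>

text \<open>Let \<open>u\<close> and \<open>l\<close> be vertices of largest and smallest degree among those still carrying labels. If
  \<open>{u, l}\<close> is an edge, then so are all pairs \<open>{u, x}\<close>; otherwise no pair \<open>{l, x}\<close> is an edge. In either case
  one side of the balance at that vertex vanishes, hence so does the other, and the vertex can be
  discarded.\<close>

lemma graph_equatable_imp_exchangeable:
  assumes H: "hypergraph 2 V H" and eq: "equatable 2 V H"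
  shows "exchangeable 2 V H"
proof (rule ccontr)
  assume ne: "\<not> exchangeable 2 V H"
  obtain y :: "'a set \<Rightarrow> real" where y: "\<forall>E\<in>[V]\<^bsup>2\<^esup>. y E \<ge> 0" "\<exists>E\<in>[V]\<^bsup>2\<^esup>. y E \<noteq> 0"
    and bal: "\<And>v. v \<in> V \<Longrightarrow>
      (\<Sum>E\<in>{E \<in> H. v \<in> E}. y E) = (\<Sum>F\<in>{F \<in> compl_edges 2 V H. v \<in> F}. y F)"
    using eq unfolding equatable_def by blast
  let ?C = "compl_edges 2 V H"
  note fin = finite_edges[OF H] and finC = finite_edges[OF hypergraph_compl[OF H]]
  have kill: "y E = 0"
    if v: "v \<in> V" and E: "E \<in> [V]\<^bsup>2\<^esup>" "v \<in> E"
      and one: "(\<forall>F\<in>?C. v \<in> F \<longrightarrow> y F = 0) \<or> (\<forall>F\<in>H. v \<in> F \<longrightarrow> y F = 0)" for v E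
  proof -
    have "(\<Sum>E\<in>{E \<in> H. v \<in> E}. y E) = 0 \<and> (\<Sum>F\<in>{F \<in> ?C. v \<in> F}. y F) = 0"
      using one bal[OF v] by auto
    then have "\<forall>E\<in>{E \<in> H. v \<in> E}. y E = 0" "\<forall>E\<in>{E \<in> ?C. v \<in> E}. y E = 0"
      using y(1) fin(2,4) finC(2,4)
      by (subst (asm) (1 2) sum_nonneg_eq_0_iff; auto)+
    then show ?thesis using E unfolding compl_edges_def by blast
  qed
  \<comment> \<open>\<open>W\<close> is the set of vertices that have not been discarded.\<close>
  have "\<forall>E\<in>[V]\<^bsup>2\<^esup>. y E = 0" if "W \<subseteq> V" "\<forall>E\<in>[V]\<^bsup>2\<^esup>. \<not> E \<subseteq> W \<longrightarrow> y E = 0" for W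
    using finite_subset[OF that(1) fin(1)] that
  proof (induction W rule: finite_psubset_induct)
    case (psubset W)
    show ?case
    proof (cases "card W \<le> 1")
      case True
      have "\<not> E \<subseteq> W" if "E \<in> [V]\<^bsup>2\<^esup>" for E
      proof
        assume "E \<subseteq> W"
        then have "card E \<le> card W" by (rule card_mono[OF psubset.hyps])
        then show False using that True by (simp add: nsets_def)
      qed
      then show ?thesis using psubset.prems by blast
    next
      case False
      then have "W \<noteq> {}" by auto
      then have "Min (degree H ` W) \<in> degree H ` W" using psubset.hyps by simp
      then obtain l where "l \<in> W" "degree H l = Min (degree H ` W)" by auto
      then have l: "l \<in> W" "\<And>x. x \<in> W \<Longrightarrow> degree H l \<le> degree H x"
        using psubset.hyps by auto
      have "W - {l} \<noteq> {}" using False l by (auto simp: card_le_Suc0_iff_eq psubset.hyps)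
      then obtain u where u: "u \<in> W - {l}" "\<And>x. x \<in> W - {l} \<Longrightarrow> degree H x \<le> degree H u"
        using ex_max_degree[of "W - {l}"] psubset.hyps by blast
      have inW: "\<exists>x\<in>W - {v}. F = {v, x}" if F: "F \<in> [V]\<^bsup>2\<^esup>" "v \<in> F" "y F \<noteq> 0" for F v
      proof -
        obtain p q where pq: "F = {p, q}" "p \<noteq> q" using F(1) by (auto simp: nsets_def card_2_iff)
        have "F \<subseteq> W" using F psubset.prems(2) by blast
        then show ?thesis using pq F(2) by auto
      qed
      have "\<exists>v\<in>W. (\<forall>F\<in>?C. v \<in> F \<longrightarrow> y F = 0) \<or> (\<forall>F\<in>H. v \<in> F \<longrightarrow> y F = 0)"
      proof (cases "{u, l} \<in> H")
        case True
        have "{u, x} \<in> H" if x: "x \<in> W - {u}" for x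
        proof (cases "x = l")
          case False
          have "insert x ({u, l} - {l}) \<in> H"
            by (rule not_exchangeable_swap[OF H ne True]) (use x l False psubset.prems(1) in auto)
          moreover have "insert x ({u, l} - {l}) = {u, x}" using u by auto
          ultimately show ?thesis by simp
        qed (use True in simp)
        then have "\<forall>F\<in>?C. u \<in> F \<longrightarrow> y F = 0"
          using inW[of _ u] unfolding compl_edges_def by blast
        then show ?thesis using u by blast
      next
        case False
        have "{l, x} \<notin> H" if "x \<in> W - {l}" for x
        proof
          assume lx: "{l, x} \<in> H"
          then have "x \<noteq> u" using False by (auto simp: insert_commute)
          then have "insert u ({l, x} - {x}) \<in> H"
            using u that psubset.prems(1) by (intro not_exchangeable_swap[OF H ne lx]) auto
          moreover have "insert u ({l, x} - {x}) = {u, l}" using that by auto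
          ultimately show False using False by simp
        qed
        then have "\<forall>F\<in>H. l \<in> F \<longrightarrow> y F = 0"
          using inW[of _ l] fin(2) by blast
        then show ?thesis using l by blast
      qed
      then obtain v where v: "v \<in> W" "(\<forall>F\<in>?C. v \<in> F \<longrightarrow> y F = 0) \<or> (\<forall>F\<in>H. v \<in> F \<longrightarrow> y F = 0)"
        by blast
      show ?thesis
      proof (rule psubset.IH[of "W - {v}"])
        show "\<forall>E\<in>[V]\<^bsup>2\<^esup>. \<not> E \<subseteq> W - {v} \<longrightarrow> y E = 0"
          using kill[of v] v psubset.prems by blast
      qed (use v psubset.prems in auto)
    qed
  qed
  from this[of V] have "\<forall>E\<in>[V]\<^bsup>2\<^esup>. y E = 0" by (auto simp: nsets_def)
  then show False using y(2) by blast
qed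

section \<open>Partite hypergraphs\<close>

text \<open>A vertex of one part cannot replace a vertex of another part in an edge. So for vertices of different
  parts, comparability means that every edge through the one of smaller degree contains
  the other. It follows that two edges differ in a single part, and that this part is the same for
  all pairs of edges: the edges are \<open>insert x e\<close> for a fixed set \<open>e\<close>. They are cut out by forbidding
  uncovered vertices and allowing at most one vertex outside \<open>e\<close>.\<close>

lemma partite_equatable_imp_exchangeable:
  assumes P: "partite_wrt k V H P" and k: "1 \<le> k" and eq: "equatable k V H"
  shows "exchangeable k V H"
proof (rule ccontr)
  assume ne: "\<not> exchangeable k V H"
  have H: "hypergraph k V H" and disj: "disjoint_family_on P {1..k}"
    and V: "(\<Union>i\<in>{1..k}. P i) = V" and one: "\<And>E i. E \<in> H \<Longrightarrow> i \<in> {1..k} \<Longrightarrow> card (E \<inter> P i) = 1"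
    using P unfolding partite_wrt_def by auto
  note edge = hypergraph_edge[OF H]
  have one': "\<exists>a. E \<inter> P i = {a}" if "E \<in> H" "i \<in> {1..k}" for E i
    using one[OF that] by (simp add: card_1_singleton_iff)
  have unique: "a = b" if E: "E \<in> H" "i \<in> {1..k}" "a \<in> E" "b \<in> E" "a \<in> P i" "b \<in> P i" for E i a b
  proof -
    obtain z where "E \<inter> P i = {z}" using one'[OF E(1,2)] by blast
    moreover have "a \<in> E \<inter> P i" "b \<in> E \<inter> P i" using E by auto
    ultimately show ?thesis by simp
  qed
  have part: "\<exists>i\<in>{1..k}. x \<in> P i" if "x \<in> V" for x using that V by blast
  have other: "i = j" if "i \<in> {1..k}" "j \<in> {1..k}" "x \<in> P i" "x \<in> P j" for i j x
    using disj that unfolding disjoint_family_on_def by blast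
  have drag: "c \<in> E" if "E \<in> H" "x \<in> E" "x \<in> P i" "c \<in> P j" "i \<noteq> j" "i \<in> {1..k}" "j \<in> {1..k}"
    "degree H x \<le> degree H c" for E x c i j
  proof (rule ccontr)
    assume c: "c \<notin> E"
    have "insert c (E - {x}) \<in> H"
      by (rule not_exchangeable_swap[OF H ne that(1,2) c _ that(8)]) (use that V in blast)
    then have "insert c (E - {x}) \<inter> P i \<noteq> {}" using one'[of "insert c (E - {x})" i] that(6) by auto
    then obtain z where "z \<in> insert c (E - {x})" "z \<in> P i" by blast
    then show False using other[of i j c] that(1-7) unique[of E i x z] by auto
  qed
  \<comment> \<open>Two edges cannot differ in two parts: comparing \<open>a\<close> and \<open>b\<close> would put one of them into both edges.\<close>
  have same: "b \<in> P i" if E: "E1 \<in> H" "E2 \<in> H" "a \<in> E1 - E2" "b \<in> E2 - E1" and a: "a \<in> P i" "i \<in> {1..k}"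
    for E1 E2 a b i
  proof (rule ccontr)
    assume "b \<notin> P i"
    moreover obtain j where "j \<in> {1..k}" "b \<in> P j" using part edge E by blast
    moreover have "degree H a \<le> degree H b \<or> degree H b \<le> degree H a" by auto
    ultimately show False using drag[of E1 a i b j] drag[of E2 b j a i] E a by blast
  qed
  have ex_diff: "\<exists>x. x \<in> E1 - E2" if "E1 \<in> H" "E2 \<in> H" "E1 \<noteq> E2" for E1 E2
    using that edge card_subset_eq[of E2 E1] by blast
  have "H \<noteq> {} \<Longrightarrow> \<exists>i\<in>{1..k}. \<exists>e. \<forall>E\<in>H. E - P i = e"
  proof -
    assume "H \<noteq> {}"
    then obtain E1 where E1: "E1 \<in> H" by blast
    show ?thesis
    proof (cases "H = {E1}")
      case True
      then show ?thesis using k by (intro bexI[of _ 1]) auto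
    next
      case False
      then obtain E2 where E2: "E2 \<in> H" "E1 \<noteq> E2" using E1 by blast
      obtain a b where ab: "a \<in> E1 - E2" "b \<in> E2 - E1" using ex_diff E1 E2 by metis
      obtain i where i: "i \<in> {1..k}" "a \<in> P i" using part ab edge E1 by blast
      have bi: "b \<in> P i" by (rule same[OF E1 E2(1) ab i(2,1)])
      have sub: "E - P i \<subseteq> E1" if E: "E \<in> H" for E
      proof (rule ccontr)
        assume "\<not> E - P i \<subseteq> E1"
        then obtain z where z: "z \<in> E" "z \<notin> P i" "z \<notin> E1" by blast
        have "a \<in> E" using same[OF E1 E _ _ i(2,1)] z ab by blast
        then have "b \<notin> E" using unique[OF E i(1) _ _ i(2) bi] ab by blast
        moreover have "z \<notin> E2" using same[OF E1 E2(1) ab(1) _ i(2,1)] z by blast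
        ultimately show False using same[OF E2(1) E _ _ bi i(1)] z ab by blast
      qed
      have "E - P i = E1 - P i" if E: "E \<in> H" for E
      proof (rule card_subset_eq)
        have "card (G - P i) = k - 1" if "G \<in> H" for G
          using card_Diff_subset_Int[of G "P i"] edge[OF that] one[OF that i(1)] by simp
        then show "card (E - P i) = card (E1 - P i)" using E E1 by simp
      qed (use edge E1 sub[OF E] in auto)
      then show ?thesis using i by blast
    qed
  qed
  then obtain i e where ie: "H \<noteq> {} \<longrightarrow> i \<in> {1..k} \<and> (\<forall>E\<in>H. E - P i = e)" by blast
  have i: "i \<in> {1..k}" if "E \<in> H" for E using ie that by blast
  have e: "E - P i = e" if "E \<in> H" for E using ie that by blast
  have struct: "\<exists>x. x \<notin> e \<and> E = insert x e" "finite e" "card e = k - 1" if E: "E \<in> H" for E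
  proof -
    have iE: "i \<in> {1..k}" using i E by blast
    obtain x where x: "E \<inter> P i = {x}" using one'[OF E iE] by blast
    show "\<exists>x. x \<notin> e \<and> E = insert x e" using x e[OF E] by (intro exI[of _ x]) blast
    then obtain x where "x \<notin> e" "E = insert x e" by blast
    then show "finite e" "card e = k - 1" using edge[OF E] by auto
  qed
  \<comment> \<open>The bound one on \<open>V - e\<close> serves both as the second and, with \<open>t = 2\<close>, as the third constraint.\<close>
  have "\<not> equatable k V H"
  proof (rule three_constraints_imp_not_equatable[OF H k, where t = 2 and A = "V - \<Union>H" and B = "V - e" and D = "V - e"])
    fix E assume E: "E \<in> H"
    then obtain x where x: "x \<notin> e" "E = insert x e" using struct by blast
    then have "E \<inter> (V - e) = {x}" using edge E by blast
    then show "E \<inter> (V - \<Union>H) = {} \<and> card (E \<inter> (V - e)) \<le> 1 \<and> card (E \<inter> (V - e)) < 2"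
      using E by auto
  next
    fix F assume F: "F \<in> [V]\<^bsup>k\<^esup>" "F \<notin> H"
    then have F': "F \<subseteq> V" "finite F" "card F = k" by (auto simp: nsets_def)
    have "F \<inter> (V - \<Union>H) \<noteq> {} \<or> 2 \<le> card (F \<inter> (V - e))"
    proof (rule ccontr)
      assume "\<not> ?thesis"
      moreover have "F \<inter> (V - e) = F - e" using F' by blast
      ultimately have c: "F \<subseteq> \<Union>H" "card (F - e) \<le> 1" using F' by auto
      have "F \<noteq> {}" using F' k by auto
      then obtain E0 where E0: "E0 \<in> H" using c by blast
      note e0 = struct(2,3)[OF E0]
      have "card F \<le> card (F \<inter> e) + card (F - e)"
        using F' by (metis card_Int_Diff order_refl)
      moreover have "card (F \<inter> e) \<le> card e" using e0(1) by (intro card_mono) auto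
      ultimately have "card (F \<inter> e) = card e" "card (F - e) = 1" using F' c e0 k by auto
      then obtain x where "F \<inter> e = e" "F - e = {x}"
        using e0 by (metis card_1_singletonE card_subset_eq Int_lower2)
      then have x: "F = insert x e" "x \<notin> e" by auto
      then obtain E where E: "E \<in> H" "x \<in> E" using c by blast
      then have "E = F" using struct(1)[OF E(1)] x by blast
      then show False using E F by simp
    qed
    then show "F \<inter> (V - \<Union>H) \<noteq> {} \<or> 2 \<le> card (F \<inter> (V - e)) \<and> 2 \<le> card (F \<inter> (V - e)) + 1
        \<or> 2 \<le> card (F \<inter> (V - e))" by auto
  qed simp
  then show False using eq by simp
qed

section \<open>Independent sets and circuits of a matroid\<close>

lemma matroid_hypergraph: "matroid k V H \<Longrightarrow> hypergraph k V H"
  unfolding matroid_def by simp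

lemma indep_subset: "indep H J \<Longrightarrow> I \<subseteq> J \<Longrightarrow> indep H I"
  unfolding indep_def by blast

lemma indep_finite: "hypergraph k V H \<Longrightarrow> indep H I \<Longrightarrow> finite I \<and> I \<subseteq> V"
  unfolding indep_def using hypergraph_edge finite_subset by (metis subset_trans)

lemma indep_imp_edge:
  assumes "hypergraph k V H" "E \<in> [V]\<^bsup>k\<^esup>" "indep H E"
  shows "E \<in> H"
proof -
  obtain B where B: "B \<in> H" "E \<subseteq> B" using assms(3) unfolding indep_def by blast
  then have "E = B" using hypergraph_edge[OF assms(1)] assms(2)
    by (intro card_subset_eq) (auto simp: nsets_def)
  then show ?thesis using B by simp
qed

text \<open>Start from any basis containing \<open>I\<close> and exchange its elements outside \<open>I \<union> B\<close> for elements of \<open>B\<close>.\<close>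

lemma matroid_extend_to_basis:
  assumes M: "matroid k V H" and I: "indep H I" and B: "B \<in> H"
  obtains B' where "B' \<in> H" "I \<subseteq> B'" "B' \<subseteq> I \<union> B"
proof -
  note edge = hypergraph_edge[OF matroid_hypergraph[OF M]]
  have "\<exists>B'\<in>H. I \<subseteq> B' \<and> B' \<subseteq> I \<union> B" if "G \<in> H" "I \<subseteq> G" for G
    using that
  proof (induction "card (G - (I \<union> B))" arbitrary: G rule: less_induct)
    case less
    show ?case
    proof (cases "G \<subseteq> I \<union> B")
      case False
      then obtain x where x: "x \<in> G" "x \<notin> I" "x \<notin> B" by blast
      then obtain z where z: "z \<in> B - G" "(G - {x}) \<union> {z} \<in> H"
        using M B less.prems unfolding matroid_def by blast
      show ?thesis
      proof (rule less.hyps[of "(G - {x}) \<union> {z}"])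
        show "card ((G - {x}) \<union> {z} - (I \<union> B)) < card (G - (I \<union> B))"
          using edge[OF less.prems(1)] x z by (intro psubset_card_mono) auto
      qed (use x z less.prems in auto)
    qed (use less.prems in blast)
  qed
  then show thesis using that I unfolding indep_def by blast
qed

text \<open>Extend \<open>J\<close> to a basis \<open>B\<close> and then \<open>I\<close> to a basis inside \<open>I \<union> B\<close>. If the latter used no element of
  \<open>J - I\<close>, it would lie in \<open>I \<union> (B - J)\<close>, which has fewer than \<open>k\<close> elements.\<close>

lemma indep_augment:
  assumes M: "matroid k V H" and I: "indep H I" and J: "indep H J" and lt: "card I < card J"
  shows "\<exists>x\<in>J - I. indep H (insert x I)"
proof -
  note H = matroid_hypergraph[OF M]
  note edge = hypergraph_edge[OF H]
  obtain B where B: "B \<in> H" "J \<subseteq> B" using J unfolding indep_def by blast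
  obtain B' where B': "B' \<in> H" "I \<subseteq> B'" "B' \<subseteq> I \<union> B"
    using matroid_extend_to_basis[OF M I B(1)] .
  have "\<exists>x. x \<in> B' \<inter> (J - I)"
  proof (rule ccontr)
    assume "\<not> ?thesis"
    then have "B' \<subseteq> I \<union> (B - J)" using B' by blast
    then have "card B' \<le> card (I \<union> (B - J))"
      using edge[OF B(1)] indep_finite[OF H I] by (intro card_mono) auto
    also have "\<dots> \<le> card I + card (B - J)" by (rule card_Un_le)
    also have "card (B - J) = card B - card J"
      using indep_finite[OF H J] B by (intro card_Diff_subset) auto
    finally show False
      using edge[OF B(1)] edge[OF B'(1)] lt card_mono[OF _ B(2)] by simp
  qed
  then show ?thesis using B' unfolding indep_def by blast
qed

lemma indep_extend_within:
  assumes M: "matroid k V H" and "indep H I" and J: "indep H J" and "card I \<le> card J"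
  shows "\<exists>K. indep H K \<and> I \<subseteq> K \<and> K \<subseteq> I \<union> J \<and> card K = card J"
  using assms(2,4)
proof (induction "card J - card I" arbitrary: I)
  case 0
  then show ?case by (intro exI[of _ I]) auto
next
  case (Suc n)
  then obtain x where x: "x \<in> J - I" "indep H (insert x I)"
    using indep_augment[OF M _ J] by (metis diff_is_0_eq nat.distinct(1) not_le)
  have "card (insert x I) = Suc (card I)"
    using x indep_finite[OF matroid_hypergraph[OF M] Suc.prems(1)] by simp
  then have "\<exists>K. indep H K \<and> insert x I \<subseteq> K \<and> K \<subseteq> insert x I \<union> J \<and> card K = card J"
    using Suc.hyps(2) x(2) by (intro Suc.hyps(1)) auto
  then show ?case using x by blast
qed

lemma dependent_contains_circuit:
  assumes "finite S" "S \<subseteq> V" "\<not> indep H S"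
  shows "\<exists>C\<subseteq>S. circuit V H C"
  using assms
proof (induction S rule: finite_psubset_induct)
  case (psubset S)
  show ?case
  proof (cases "circuit V H S")
    case False
    then obtain I where "I \<subset> S" "\<not> indep H I" using psubset.prems unfolding circuit_def by blast
    then show ?thesis using psubset.IH[of I] psubset.prems by blast
  qed blast
qed

lemma circuit_nonempty: "matroid k V H \<Longrightarrow> circuit V H C \<Longrightarrow> C \<noteq> {}"
  unfolding circuit_def matroid_def indep_def by auto

lemma circuit_finite:
  assumes "matroid k V H" "circuit V H C"
  shows "finite C"
  using assms(2) finite_edges(1)[OF matroid_hypergraph[OF assms(1)]]
  unfolding circuit_def by (meson finite_subset)

lemma nonbasis_contains_circuit:
  assumes M: "matroid k V H" and F: "F \<in> [V]\<^bsup>k\<^esup>" "F \<notin> H"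
  obtains C where "C \<subseteq> F" "circuit V H C" "C \<noteq> {}" "finite C"
proof -
  have "\<not> indep H F" using indep_imp_edge[OF matroid_hypergraph[OF M] F(1)] F(2) by blast
  then obtain C where C: "C \<subseteq> F" "circuit V H C"
    using dependent_contains_circuit[of F V H] F(1) by (auto simp: nsets_def)
  show thesis by (rule that[OF C circuit_nonempty[OF M C(2)] circuit_finite[OF M C(2)]])
qed

section \<open>Circuits of a non-exchangeable matroid\<close>

definition top_of :: "'a set set \<Rightarrow> 'a set \<Rightarrow> 'a \<Rightarrow> bool" where
  "top_of H C c \<longleftrightarrow> c \<in> C \<and> (\<forall>x\<in>C. degree H x \<le> degree H c)"

definition below :: "'a set \<Rightarrow> 'a set set \<Rightarrow> 'a \<Rightarrow> 'a set" where
  "below V H c = {x \<in> V. degree H x \<le> degree H c}"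

text \<open>In a matroid without an exchange, a circuit of size at most \<open>s\<close> with top \<open>c\<close> forces \<open>below V H c\<close> to
  have rank less than \<open>s\<close>; the layer collects these sets. The sets
  \<open>below V H c\<close> form a chain, so the union is the largest of them (or empty), and as \<open>s\<close> grows the
  layers form a chain themselves.\<close>

definition circuit_layer :: "'a set \<Rightarrow> 'a set set \<Rightarrow> nat \<Rightarrow> 'a set" where
  "circuit_layer V H s = \<Union> {below V H c |C c. circuit V H C \<and> card C \<le> s \<and> top_of H C c}"

lemma ex_top:
  assumes "finite C" "C \<noteq> {}"
  obtains c where "top_of H C c"
  using ex_max_degree[OF assms] unfolding top_of_def by metis

lemma top_of_below: "C \<subseteq> V \<Longrightarrow> top_of H C c \<Longrightarrow> C \<subseteq> below V H c"
  unfolding top_of_def below_def by auto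

text \<open>An independent \<open>I\<close> with at least \<open>card C\<close> elements would augment \<open>C - {c}\<close> by some \<open>x\<close> with \<open>deg x \<le> deg c\<close>.
  In a basis containing the result, \<open>x\<close> can be replaced by \<open>c\<close>, and this produces a basis
  containing the circuit \<open>C\<close>.\<close>

lemma indep_below_top:
  assumes M: "matroid k V H" and ne: "\<not> exchangeable k V H"
    and C: "circuit V H C" and c: "top_of H C c" and I: "indep H I" "I \<subseteq> below V H c"
  shows "card I < card C"
proof (rule ccontr)
  assume ge: "\<not> card I < card C"
  note H = matroid_hypergraph[OF M]
  have fin: "finite C" using circuit_finite[OF M C] .
  have cC: "c \<in> C" "C \<subseteq> V" using c C unfolding top_of_def circuit_def by auto
  have "indep H (C - {c})" using C cC unfolding circuit_def by blast
  moreover have "card (C - {c}) < card I" using ge card_Diff1_less[OF fin cC(1)] by simp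
  ultimately obtain x where x: "x \<in> I - (C - {c})" "indep H (insert x (C - {c}))"
    using indep_augment[OF M _ I(1)] by blast
  have notC: "\<not> indep H C" using C unfolding circuit_def by simp
  have xc: "x \<noteq> c" using x(2) notC cC by (auto simp: insert_absorb)
  obtain E where E: "E \<in> H" "insert x (C - {c}) \<subseteq> E" using x(2) unfolding indep_def by blast
  have "c \<notin> E" using E notC unfolding indep_def by blast
  then have "insert c (E - {x}) \<in> H"
    using E I x cC xc by (intro not_exchangeable_swap[OF H ne]) (auto simp: below_def)
  moreover have "C \<subseteq> insert c (E - {x})" using E x xc by blast
  ultimately show False using notC unfolding indep_def by blast
qed

text \<open>An element of \<open>E\<close> in the layer with the largest degree comes from some circuit \<open>C\<close>, and by the choice
  of the element the whole intersection lies in the set of rank \<open>card C - 1\<close> belonging to \<open>C\<close>.\<close>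

lemma circuit_layer_rank:
  assumes M: "matroid k V H" and ne: "\<not> exchangeable k V H" and E: "E \<in> H" and s: "1 \<le> s"
  shows "card (E \<inter> circuit_layer V H s) < s"
proof (cases "E \<inter> circuit_layer V H s = {}")
  case False
  have "finite E" using hypergraph_edge[OF matroid_hypergraph[OF M] E] by simp
  then obtain x where x: "x \<in> E" "x \<in> circuit_layer V H s"
    "\<And>z. z \<in> E \<inter> circuit_layer V H s \<Longrightarrow> degree H z \<le> degree H x"
    using ex_max_degree[OF _ False] by blast
  then obtain C c where C: "circuit V H C" "card C \<le> s" "top_of H C c" "x \<in> below V H c"
    unfolding circuit_layer_def by blast
  have "E \<inter> circuit_layer V H s \<subseteq> below V H c"
  proof
    fix z assume z: "z \<in> E \<inter> circuit_layer V H s"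
    then have "z \<in> V" unfolding circuit_layer_def below_def by blast
    then show "z \<in> below V H c" using x(3)[OF z] C(4) unfolding below_def by simp
  qed
  moreover have "indep H (E \<inter> circuit_layer V H s)" using E unfolding indep_def by blast
  ultimately show ?thesis using indep_below_top[OF M ne C(1,3)] C(2) by fastforce
qed (use s in simp)

lemma circuit_subset_layer:
  assumes M: "matroid k V H" and C: "circuit V H C" "card C \<le> s"
  shows "C \<subseteq> circuit_layer V H s"
proof -
  obtain c where c: "top_of H C c" using ex_top circuit_finite[OF M C(1)] circuit_nonempty[OF M C(1)] .
  have "C \<subseteq> V" using C unfolding circuit_def by blast
  then have "C \<subseteq> below V H c" using top_of_below c by metis
  then show ?thesis using C c unfolding circuit_layer_def by blast
qed

lemma circuit_layer_mono: "s \<le> t \<Longrightarrow> circuit_layer V H s \<subseteq> circuit_layer V H t"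
  unfolding circuit_layer_def by (fastforce intro: le_trans)

text \<open>Together with the preceding rank bound this describes the bases: a non-basis contains a circuit,
  and so violates the bound of the layer indexed by the size of that circuit.\<close>

lemma circuit_card_le_inter_layer:
  assumes M: "matroid k V H" and C: "circuit V H C" "C \<subseteq> F" "finite F"
  shows "card C \<le> card (F \<inter> circuit_layer V H (card C))"
  using circuit_subset_layer[OF M C(1) order_refl] C by (intro card_mono) auto

section \<open>Paving matroids and matroids of rank three\<close>

text \<open>In a paving matroid a circuit inside a \<open>k\<close>-set is the whole set, so only the layer of index \<open>k\<close>
  imposes a condition.\<close>

lemma paving_equatable_imp_exchangeable:
  assumes P: "paving_matroid k V H" and k: "1 \<le> k" and eq: "equatable k V H"
  shows "exchangeable k V H"
proof (rule ccontr)
  assume ne: "\<not> exchangeable k V H"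
  have M: "matroid k V H" and pav: "\<And>I. I \<in> [V]\<^bsup>(k - 1)\<^esup> \<Longrightarrow> indep H I"
    using P unfolding paving_matroid_def by auto
  have "\<not> equatable k V H"
  proof (rule three_constraints_imp_not_equatable[OF matroid_hypergraph[OF M] k k,
        where A = "{}" and B = "{}" and D = "circuit_layer V H k"])
    fix F assume F: "F \<in> [V]\<^bsup>k\<^esup>" "F \<notin> H"
    obtain C where C: "C \<subseteq> F" "circuit V H C" "C \<noteq> {}" "finite C"
      using nonbasis_contains_circuit[OF M F] .
    have F': "F \<subseteq> V" "finite F" "card F = k" using F by (auto simp: nsets_def)
    have "C = F"
    proof (rule ccontr)
      assume "C \<noteq> F"
      then obtain x where x: "x \<in> F" "x \<notin> C" using C by blast
      then have "F - {x} \<in> [V]\<^bsup>(k - 1)\<^esup>" using F' by (auto simp: nsets_def)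
      then show False using pav C x indep_subset[of H "F - {x}" C] unfolding circuit_def by blast
    qed
    then show "F \<inter> {} \<noteq> {} \<or> 2 \<le> card (F \<inter> {}) \<and> k \<le> card (F \<inter> circuit_layer V H k) + 1
        \<or> k \<le> card (F \<inter> circuit_layer V H k)"
      using circuit_card_le_inter_layer[OF M C(2,1)] F' by simp
  qed (use circuit_layer_rank[OF M ne _ k] in auto)
  then show False using eq by simp
qed

text \<open>The circuits inside a non-basis have size one, two or three and violate the bound of the corresponding
  layer. As the second layer lies in the third, two elements of the second are \<open>t - 1 = 2\<close> elements of
  the third.\<close>

lemma matroid3_equatable_imp_exchangeable:
  assumes M: "matroid 3 V H" and eq: "equatable 3 V H"
  shows "exchangeable 3 V H"
proof (rule ccontr)
  assume ne: "\<not> exchangeable 3 V H"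
  let ?D = "circuit_layer V H"
  note H = matroid_hypergraph[OF M]
  have "\<not> equatable 3 V H"
  proof (rule three_constraints_imp_not_equatable[OF H,
        where A = "?D 1" and B = "?D 2" and D = "?D 3" and t = 3])
    fix E assume E: "E \<in> H"
    have "finite E" using hypergraph_edge[OF H E] by simp
    then show "E \<inter> ?D 1 = {} \<and> card (E \<inter> ?D 2) \<le> 1 \<and> card (E \<inter> ?D 3) < 3"
      using circuit_layer_rank[OF M ne E, of 1] circuit_layer_rank[OF M ne E, of 2]
        circuit_layer_rank[OF M ne E, of 3] by simp
  next
    fix F assume F: "F \<in> [V]\<^bsup>3\<^esup>" "F \<notin> H"
    obtain C where C: "C \<subseteq> F" "circuit V H C" "C \<noteq> {}" "finite C"
      using nonbasis_contains_circuit[OF M F] .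
    have F': "finite F" "card F = 3" using F by (auto simp: nsets_def)
    have le: "card C \<le> card (F \<inter> ?D (card C))"
      by (rule circuit_card_le_inter_layer[OF M C(2,1) F'(1)])
    have "card (F \<inter> ?D 2) \<le> card (F \<inter> ?D 3)"
      using F' circuit_layer_mono[of 2 3 V H] by (intro card_mono) auto
    moreover have "card C = 1 \<or> card C = 2 \<or> card C = 3"
      using C card_mono[OF F'(1) C(1)] F'(2) card_gt_0_iff[of C] by linarith
    ultimately show "F \<inter> ?D 1 \<noteq> {} \<or> 2 \<le> card (F \<inter> ?D 2) \<and> 3 \<le> card (F \<inter> ?D 3) + 1
        \<or> 3 \<le> card (F \<inter> ?D 3)" using le by auto
  qed auto
  then show False using eq by simp
qed

section \<open>Binary matroids\<close>

text \<open>Suppose that \<open>C'\<close> has at least three elements. All sets \<open>C' - {z}\<close> with \<open>z \<in> C'\<close> span the same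
  elements, so one set \<open>J\<close> extends each of them to an independent set of the maximal
  size \<open>card C - 1\<close> below \<open>c\<close>. Adding \<open>c\<close> gives a circuit: it has \<open>card C\<close> elements, and this is the
  size of every circuit with top \<open>c\<close>. For two choices \<open>a\<close>, \<open>b\<close> of \<open>z\<close> the two circuits have symmetric
  difference \<open>{a, b}\<close>, which contains no circuit since it is a proper subset of \<open>C'\<close>; a
  binary matroid does not allow this.\<close>

lemma binary_circuit_avoiding_top:
  assumes bin: "binary_matroid k V H" and ne: "\<not> exchangeable k V H"
    and C: "circuit V H C" and c: "top_of H C c"
    and C': "circuit V H C'" "C' \<subseteq> below V H c" "c \<notin> C'"
  shows "card C' \<le> 2"
proof (rule ccontr)
  assume gt: "\<not> card C' \<le> 2"
  have M: "matroid k V H" using bin unfolding binary_matroid_def by simp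
  note H = matroid_hypergraph[OF M]
  have fin: "finite C" "finite C'" using circuit_finite[OF M] C C' by auto
  have cC: "c \<in> C" "C \<subseteq> V" "c \<in> V" "C \<subseteq> below V H c"
    using c C top_of_below[of C V H c] unfolding top_of_def circuit_def by auto
  have rank: "card I \<le> card (C - {c})" if "indep H I" "I \<subseteq> below V H c" for I
    using indep_below_top[OF M ne C c that] fin cC by simp
  have ind: "indep H (C - {c})" using C cC unfolding circuit_def by blast
  have ind': "indep H (C' - {a})" if "a \<in> C'" for a
    using C' that unfolding circuit_def by blast
  have dep: "\<not> indep H C'" using C' unfolding circuit_def by simp
  obtain a where a: "a \<in> C'" using gt by fastforce
  have "C' - {a} \<noteq> {}" using gt a fin by (metis card.empty card_Diff_singleton diff_is_0_eq
        nat_le_linear le_trans one_le_numeral)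
  then obtain b where b: "b \<in> C'" "b \<noteq> a" by blast
  \<comment> \<open>The extension uses only elements of \<open>C - {c}\<close>, so that \<open>c\<close> remains available as the last element of
    the circuits.\<close>
  obtain K where K: "indep H K" "C' - {a} \<subseteq> K" "K \<subseteq> (C' - {a}) \<union> (C - {c})"
      "card K = card (C - {c})"
    using indep_extend_within[OF M ind'[OF a] ind] rank[OF ind'[OF a]] C' by blast
  have aK: "a \<notin> K" using K dep indep_subset[of H K C'] by blast
  define J where "J = K - C'"
  have KJ: "K = (C' - {a}) \<union> J" using K aK unfolding J_def by blast
  have finJ: "finite J" using indep_finite[OF H K(1)] unfolding J_def by simp
  have cJ: "card ((C' - {z}) \<union> J) = card (C - {c})" if "z \<in> C'" for z
  proof -
    have "card ((C' - {z}) \<union> J) = card (C' - {z}) + card J"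
      using finJ fin unfolding J_def by (intro card_Un_disjoint) auto
    also have "\<dots> = card (C' - {a}) + card J" using that a fin by simp
    also have "\<dots> = card K" unfolding KJ
      using finJ fin unfolding J_def by (intro card_Un_disjoint[symmetric]) auto
    finally show ?thesis using K by simp
  qed
  have indJ: "indep H ((C' - {z}) \<union> J)" if z: "z \<in> C'" for z
  proof -
    have "card (C' - {z}) \<le> card K" using rank[OF ind'[OF z]] C' K by auto
    then obtain L where L: "indep H L" "C' - {z} \<subseteq> L" "L \<subseteq> (C' - {z}) \<union> K" "card L = card K"
      using indep_extend_within[OF M ind'[OF z] K(1)] by blast
    have "z \<notin> L" using L dep indep_subset[of H L C'] by blast
    then have "L \<subseteq> (C' - {z}) \<union> J" using L KJ by blast
    moreover have "card L = card ((C' - {z}) \<union> J)" using L K cJ[OF z] by simp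
    ultimately have "L = (C' - {z}) \<union> J" using finJ fin by (intro card_subset_eq) auto
    then show ?thesis using L by simp
  qed
  have cX: "c \<notin> (C' - {z}) \<union> J" for z using K C' unfolding J_def by blast
  have circ: "circuit V H (insert c ((C' - {z}) \<union> J))" if z: "z \<in> C'" for z
  proof -
    let ?X = "insert c ((C' - {z}) \<union> J)"
    have X: "?X \<subseteq> below V H c" "finite ?X" "card ?X = card C"
      using C' K cC finJ fin cJ[OF z] cX[of z] card_gt_0_iff[of C]
      unfolding J_def by (auto simp: card_Diff_singleton)
    have "\<not> indep H ?X" using indep_below_top[OF M ne C c _ X(1)] X(3) by auto
    then obtain Y where Y: "Y \<subseteq> ?X" "circuit V H Y"
      using dependent_contains_circuit[OF X(2), of V] X(1) unfolding below_def by blast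
    have "c \<in> Y" using Y indJ[OF z] indep_subset[of H "(C' - {z}) \<union> J" Y] unfolding circuit_def by blast
    then have "top_of H Y c" using Y X(1) unfolding top_of_def below_def by blast
    moreover have "C - {c} \<subseteq> below V H c" using cC by blast
    ultimately have "card (C - {c}) < card Y" using indep_below_top[OF M ne Y(2) _ ind] by blast
    then have "card C \<le> card Y" using cC fin by simp
    then have "Y = ?X" using X Y by (intro card_seteq) auto
    then show ?thesis using Y by simp
  qed
  let ?Xa = "insert c ((C' - {a}) \<union> J)" and ?Xb = "insert c ((C' - {b}) \<union> J)"
  have sd: "sym_diff ?Xa ?Xb = {a, b}" using a b C' unfolding J_def by auto
  then have "?Xa \<noteq> ?Xb" by auto
  then obtain \<C> where U: "\<forall>C\<in>\<C>. circuit V H C" "{a, b} = \<Union>\<C>"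
    using bin circ[OF a] circ[OF b(1)] unfolding binary_matroid_def sd[symmetric] by metis
  then obtain Z where Z: "circuit V H Z" "Z \<subseteq> {a, b}" by blast
  have "card {a, b} < card C'" using gt card_insert_le_m1[of 2 "{b}" a] by (simp add: b)
  then have "{a, b} \<subset> C'" using a b by auto
  then have "indep H {a, b}" using C' unfolding circuit_def by blast
  then show False using Z indep_subset[of H "{a, b}" Z] unfolding circuit_def by blast
qed

text \<open>If all circuits lie below \<open>c\<close>, the remaining elements are coloops, that is, they belong to every basis.
  A basis containing \<open>C - {c}\<close> shows that there are at most \<open>k + 1 - card C\<close> of them, and so
  every \<open>k\<close>-set has at least \<open>card C - 1\<close> elements below \<open>c\<close>.\<close>

lemma coloops_complement_below:
  assumes M: "matroid k V H" and C: "circuit V H C" and c: "top_of H C c"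
    and top: "\<And>C'. circuit V H C' \<Longrightarrow> C' \<subseteq> below V H c"
    and F: "F \<in> [V]\<^bsup>k\<^esup>"
  shows "card C \<le> card (F \<inter> below V H c) + 1"
proof -
  note H = matroid_hypergraph[OF M]
  note edge = hypergraph_edge[OF H]
  let ?D = "below V H c"
  have finC: "finite C" using circuit_finite[OF M C] .
  have cC: "c \<in> C" "C \<subseteq> V" using c C unfolding top_of_def circuit_def by auto
  have F': "F \<subseteq> V" "finite F" "card F = k" using F by (auto simp: nsets_def)
  have "indep H (C - {c})" using C cC unfolding circuit_def by blast
  then obtain E where E: "E \<in> H" "C - {c} \<subseteq> E" unfolding indep_def by blast
  have "V - ?D \<subseteq> E"
  proof
    fix x assume x: "x \<in> V - ?D"
    show "x \<in> E"
    proof (rule ccontr)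
      assume xE: "x \<notin> E"
      have "\<not> indep H (insert x E)"
      proof
        assume "indep H (insert x E)"
        then obtain B where B: "B \<in> H" "insert x E \<subseteq> B" unfolding indep_def by blast
        then show False
          using edge[OF B(1)] edge[OF E(1)] xE card_mono[of B "insert x E"] by simp
      qed
      then obtain Y where Y: "Y \<subseteq> insert x E" "circuit V H Y"
        using dependent_contains_circuit[of "insert x E" V H] edge[OF E(1)] x by auto
      then have "x \<notin> Y" using top x by blast
      then have "Y \<subseteq> E" using Y by blast
      then have "indep H Y" using E unfolding indep_def by blast
      then show False using Y unfolding circuit_def by blast
    qed
  qed
  then have "card (F - ?D) \<le> card (E - ?D)"
    using edge[OF E(1)] F' by (intro card_mono) auto
  moreover have "card (F - ?D) + card (F \<inter> ?D) = k" "card (E - ?D) + card (E \<inter> ?D) = k"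
    using card_Int_Diff[of F ?D] card_Int_Diff[of E ?D] F' edge[OF E(1)] by auto
  moreover have "card (C - {c}) \<le> card (E \<inter> ?D)"
    using E edge[OF E(1)] top[OF C] by (intro card_mono) auto
  ultimately show ?thesis using finC cC by simp
qed

text \<open>Let \<open>c\<close> have the largest degree among all elements of circuits, and let \<open>C\<close> be a circuit through it. A
  circuit inside a non-basis either contains \<open>c\<close>, and then has at least \<open>card C\<close> elements below \<open>c\<close>, or
  it has at most two elements and violates the bound of the first or second layer.\<close>

lemma binary_equatable_imp_exchangeable:
  assumes bin: "binary_matroid k V H" and k: "1 \<le> k" and eq: "equatable k V H"
  shows "exchangeable k V H"
proof (rule ccontr)
  assume ne: "\<not> exchangeable k V H"
  have M: "matroid k V H" using bin unfolding binary_matroid_def by simp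
  note H = matroid_hypergraph[OF M]
  let ?D = "circuit_layer V H" and ?U = "\<Union> {C. circuit V H C}"
  have "\<not> equatable k V H"
  proof (cases "?U = {}")
    case True
    have "F \<in> H" if "F \<in> [V]\<^bsup>k\<^esup>" for F
      using nonbasis_contains_circuit[OF M that] True by blast
    then show ?thesis
      using three_constraints_imp_not_equatable[OF H k order_refl, of "{}" "{}" "{}"] by auto
  next
    case False
    have "finite ?U" using finite_edges(1)[OF H] by (rule rev_finite_subset) (auto simp: circuit_def)
    then obtain c where c: "c \<in> ?U" "\<And>x. x \<in> ?U \<Longrightarrow> degree H x \<le> degree H c"
      using ex_max_degree[OF _ False] by blast
    then obtain C where C: "circuit V H C" "c \<in> C" by blast
    have top: "C' \<subseteq> below V H c" if "circuit V H C'" for C'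
      using that c(2) unfolding below_def circuit_def by blast
    have tops: "top_of H C' c" if "circuit V H C'" "c \<in> C'" for C'
      using that c(2) unfolding top_of_def by blast
    have finC: "finite C" "1 \<le> card C" using circuit_finite[OF M C(1)] C(2)
      by (auto simp: Suc_le_eq card_gt_0_iff)
    show ?thesis
    proof (rule three_constraints_imp_not_equatable[OF H k finC(2),
          where A = "?D 1" and B = "?D 2" and D = "below V H c"])
      fix E assume E: "E \<in> H"
      have "finite E" using hypergraph_edge[OF H E] by simp
      moreover have "indep H (E \<inter> below V H c)" using E unfolding indep_def by blast
      ultimately show "E \<inter> ?D 1 = {} \<and> card (E \<inter> ?D 2) \<le> 1 \<and> card (E \<inter> below V H c) < card C"
        using circuit_layer_rank[OF M ne E, of 1] circuit_layer_rank[OF M ne E, of 2]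
          indep_below_top[OF M ne C(1) tops[OF C]] by simp
    next
      fix F assume F: "F \<in> [V]\<^bsup>k\<^esup>" "F \<notin> H"
      obtain C' where C': "C' \<subseteq> F" "circuit V H C'" "C' \<noteq> {}" "finite C'"
        using nonbasis_contains_circuit[OF M F] .
      have finF: "finite F" using F by (simp add: nsets_def)
      have le: "card C' \<le> card (F \<inter> ?D (card C'))"
        by (rule circuit_card_le_inter_layer[OF M C'(2,1) finF])
      show "F \<inter> ?D 1 \<noteq> {} \<or> 2 \<le> card (F \<inter> ?D 2) \<and> card C \<le> card (F \<inter> below V H c) + 1
          \<or> card C \<le> card (F \<inter> below V H c)"
      proof (cases "c \<in> C'")
        case True
        have "indep H (C - {c})" using C unfolding circuit_def by blast
        moreover have "C - {c} \<subseteq> below V H c" using top[OF C(1)] by blast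
        ultimately have "card (C - {c}) < card C'"
          by (rule indep_below_top[OF M ne C'(2) tops[OF C'(2) True]])
        then have "card C \<le> card C'" using C finC by simp
        also have "\<dots> \<le> card (F \<inter> below V H c)"
          using C' top[OF C'(2)] finF by (intro card_mono) auto
        finally show ?thesis by simp
      next
        case False
        have "card C' \<le> 2"
          by (rule binary_circuit_avoiding_top[OF bin ne C(1) tops[OF C] C'(2) top[OF C'(2)] False])
        then have "card C' = 1 \<or> card C' = 2"
          using C' card_gt_0_iff[of C'] by linarith
        then show ?thesis
          using le coloops_complement_below[OF M C(1) tops[OF C] top F(1)] by auto
      qed
    qed
  qed
  then show False using eq by simp
qed

section \<open>Equatability and exchangeability agree\<close>

text \<open>With this single part, edges of size one are a special case of the partite hypergraphs.\<close>

lemma singleton_edges_partite: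
  assumes H: "hypergraph 1 V H"
  shows "partite_wrt 1 V H (\<lambda>_. V)"
proof -
  have "card (E \<inter> V) = 1" if "E \<in> H" for E
    using hypergraph_edge[OF H that] by (simp add: inf_absorb1)
  then show ?thesis using H by (simp add: partite_wrt_def disjoint_family_on_def)
qed

lemma equatable_iff_exchangeable:
  assumes H: "hypergraph k V H" and k: "1 \<le> k"
    and cases: "k \<in> {1, 2} \<or> (\<exists>P. partite_wrt k V H P) \<or> paving_matroid k V H \<or>
         binary_matroid k V H \<or> (k = 3 \<and> matroid 3 V H)"
  shows "equatable k V H \<longleftrightarrow> exchangeable k V H"
proof
  assume eq: "equatable k V H"
  from cases consider "k = 1" | "k = 2" | P where "partite_wrt k V H P" | "paving_matroid k V H"
    | "binary_matroid k V H" | "k = 3" "matroid 3 V H" by auto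
  then show "exchangeable k V H"
  proof cases
    case 1
    then show ?thesis
      using partite_equatable_imp_exchangeable[OF singleton_edges_partite] H eq by simp
  next
    case 2
    then show ?thesis using graph_equatable_imp_exchangeable H eq by simp
  next
    case 3
    then show ?thesis by (rule partite_equatable_imp_exchangeable[OF _ k eq])
  next
    case 4
    then show ?thesis by (rule paving_equatable_imp_exchangeable[OF _ k eq])
  next
    case 5
    then show ?thesis by (rule binary_equatable_imp_exchangeable[OF _ k eq])
  next
    case 6
    then show ?thesis using matroid3_equatable_imp_exchangeable eq by simp
  qed
qed (rule exchangeable_imp_equatable[OF H])

text \<open>The dual has edges of size one or two.\<close>

lemma equatable_iff_exchangeable_small_corank:
  assumes H: "hypergraph k V H" and k: "1 \<le> k" and n: "card V = k + 1 \<or> card V = k + 2"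
  shows "equatable k V H \<longleftrightarrow> exchangeable k V H"
proof -
  have kn: "k < card V" using n by auto
  have "card V - k \<in> {1, 2}" using n by auto
  then have "equatable (card V - k) V (dual_edges V H) \<longleftrightarrow> exchangeable (card V - k) V (dual_edges V H)"
    using kn by (intro equatable_iff_exchangeable hypergraph_dual[OF H]) auto
  then show ?thesis using equatable_dual[OF H k kn] exchangeable_dual[OF H kn] by simp
qed

lemma compl_dual_equatable_iff_exchangeable:
  assumes "hypergraph k V H" "1 \<le> k" "k < card V"
    and "k \<in> {1, 2} \<or> (\<exists>P. partite_wrt k V H P) \<or> paving_matroid k V H \<or>
         binary_matroid k V H \<or> (k = 3 \<and> matroid 3 V H)"
  shows "equatable k V (compl_edges k V H) \<longleftrightarrow> exchangeable k V (compl_edges k V H)"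
    and "equatable (card V - k) V (dual_edges V H) \<longleftrightarrow>
      exchangeable (card V - k) V (dual_edges V H)"
  unfolding equatable_compl[OF assms(1)] exchangeable_compl[OF assms(1)]
    equatable_dual[OF assms(1-3)] exchangeable_dual[OF assms(1,3)]
  by (rule equatable_iff_exchangeable[OF assms(1,2,4)])+

theorem corollary1p4:
  shows
    "(\<forall>k n (V :: 'a set) H.
        1 \<le> k \<and> k < n \<and> hypergraph k V H \<and> n = card V \<and>
        (k \<in> {1, 2} \<or> (\<exists>P. partite_wrt k V H P) \<or> paving_matroid k V H \<or>
         binary_matroid k V H \<or> (k = 3 \<and> matroid 3 V H)) \<longrightarrow>
        (equatable k V (compl_edges k V H) \<longleftrightarrow> exchangeable k V (compl_edges k V H)) \<and>
        (equatable (n - k) V (dual_edges V H) \<longleftrightarrow> exchangeable (n - k) V (dual_edges V H)))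
     \<and>
     (\<forall>k n (V :: 'a set) H.
        1 \<le> k \<and> hypergraph k V H \<and> n = card V \<and> (n = k + 1 \<or> n = k + 2) \<longrightarrow>
        (equatable k V H \<longleftrightarrow> exchangeable k V H))
     \<and>
     (\<forall>k n (V :: 'a set) H.
        1 \<le> k \<and> k < n \<and> n = card V \<and> paving_matroid k V H \<longrightarrow>
        (equatable (n - k) V (dual_edges V H) \<longleftrightarrow> exchangeable (n - k) V (dual_edges V H)))
     \<and>
     (\<forall>n (V :: 'a set) H.
        3 < n \<and> n = card V \<and> matroid 3 V H \<longrightarrow>
        (equatable (n - 3) V (dual_edges V H) \<longleftrightarrow> exchangeable (n - 3) V (dual_edges V H)))"
proof (intro conjI allI impI, goal_cases)
  case (1 k n V H)
  then have n: "n = card V" by (elim conjE)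
  from 1[unfolded n] show ?case
    by (elim conjE) (rule compl_dual_equatable_iff_exchangeable(1); assumption)
next
  case (2 k n V H)
  then have n: "n = card V" by (elim conjE)
  from 2[unfolded n] show ?case
    unfolding n by (elim conjE) (rule compl_dual_equatable_iff_exchangeable(2); assumption)
next
  case (3 k n V H)
  then have n: "n = card V" by (elim conjE)
  from 3[unfolded n] show ?case
    by (elim conjE) (rule equatable_iff_exchangeable_small_corank; assumption)
next
  case (4 k n V H)
  then have n: "n = card V" by (elim conjE)
  have "hypergraph k V H" using 4 matroid_hypergraph[of k V H] unfolding paving_matroid_def by simp
  then show ?case
    unfolding n by (rule compl_dual_equatable_iff_exchangeable(2)) (use 4 in simp_all)
next
  case (5 n V H)
  then have n: "n = card V" by (elim conjE)
  have "hypergraph 3 V H" using 5 matroid_hypergraph[of 3 V H] by simp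
  then show ?case
    unfolding n by (rule compl_dual_equatable_iff_exchangeable(2)) (use 5 in simp_all)
qed

end
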